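(* Let $E$ be an order continuous Banach lattice with a weak unit, represented as a Köthe function space over a probability space $(\Omega,\Sigma,\mu)$ as described in the context, let $Y$ be a Banach space and $T\in \mathrm{L}(E,Y)$. The following are equivalent: (1) $T$ is disjointly non-singular. (2) There exists $r>0$ such that for every sequence $(x_n)$ in $S_E$ with $\lim_{n\to\infty}\mu(\operatorname{supp} x_n)=0$ we have $\liminf_{n\to\infty}\|Tx_n\|>r$. (3) For every sequence $(x_n)$ in $S_E$ with $\lim_{n\to\infty}\mu(\operatorname{supp} x_n)=0$ we have $\liminf_{n\to\infty}\|Tx_n\|>0$. (4) There is $r>0$ such that for every $x\in S_E$ with $\mu(\operatorname{supp} x)<r$ we have $\|Tx\|>r$.
   Context: Operators are bounded linear maps; $\mathrm{L}(E,Y)$ denotes the operators from $E$ to $Y$, and $S_E$ is the unit sphere of $E$. A Banach lattice $E$ is order continuous if every net decreasing in order to $0$ converges in norm to $0$; $e\in E_+$ is a weak unit if $|x|\wedge e=0$ implies $x=0$. Representation: every order continuous Banach lattice $E$ with a weak unit can be represented over a probability space $(\Omega,\Sigma,\mu)$ so that $L_\infty(\mu)\subset E\subset L_1(\mu)$, $E$ is dense in $L_1(\mu)$, $L_\infty(\mu)$ is dense in $E$, $\|f\|_1\le\|f\|_E\le 2\|f\|_\infty$ for $f\in L_\infty(\mu)$, and the order of $E$ is the one induced by $L_1(\mu)$; such a representation is fixed. For $x\in E$, $\operatorname{supp}x=\{t\in\Omega: x(t)\neq 0\}$. For a sequence $(x_n)$, $[x_n]$ is its closed linear span. An operator is strictly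 singular if it is an isomorphism on no closed infinite-dimensional subspace. An operator $T\in\mathrm{L}(E,Y)$ is disjointly non-singular ($T\in\mathrm{DN\text{-}S}(E,Y)$) if there is no disjoint sequence $(x_n)$ of non-zero vectors of $E$ such that the restriction of $T$ to $[x_n]$ is strictly singular. *)

theory Defs
  imports "HOL-Probability.Probability"
begin

text \<open>Banach lattices are modelled as a type of class banach, ordered_real_vector and lattice
(the order of the vector lattice), together with the lattice-norm axiom stated in the theorem.\<close>

definition labs :: "'e::{lattice,uminus} \<Rightarrow> 'e" where
  "labs x = sup x (- x)"

definition order_continuous :: "('e::{real_normed_vector,ordered_real_vector,lattice}) itself \<Rightarrow> bool" where
  "order_continuous _ \<longleftrightarrow>
     (\<forall>D::'e set. D \<noteq> {} \<and> (\<forall>a\<in>D. \<forall>b\<in>D. \<exists>c\<in>D. c \<le> a \<and> c \<le> b)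
        \<and> (\<forall>d\<in>D. 0 \<le> d) \<and> (\<forall>z. (\<forall>d\<in>D. z \<le> d) \<longrightarrow> z \<le> 0)
        \<longrightarrow> (\<forall>\<epsilon>>0. \<exists>d0\<in>D. \<forall>d\<in>D. d \<le> d0 \<longrightarrow> norm d < \<epsilon>))"

definition weak_unit :: "'e::{ordered_real_vector,lattice} \<Rightarrow> bool" where
  "weak_unit e \<longleftrightarrow> 0 \<le> e \<and> (\<forall>x. inf (labs x) e = 0 \<longrightarrow> x = 0)"

text \<open>Representation of E as a Koethe function space over the probability space M,
via the (representative-choosing) map J : E -> functions on Omega.\<close>
definition koethe_rep :: "'w measure \<Rightarrow> ('e::{real_normed_vector,ordered_real_vector,lattice} \<Rightarrow> 'w \<Rightarrow> real) \<Rightarrow> bool" where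
  "koethe_rep M J \<longleftrightarrow>
     prob_space M \<and> (\<forall>t. linear (\<lambda>x. J x t))
     \<and> (\<forall>x. J x \<in> borel_measurable M \<and> integrable M (J x))
     \<and> (\<forall>x y. x \<le> y \<longleftrightarrow> (AE t in M. J x t \<le> J y t))
     \<and> (\<forall>f\<in>borel_measurable M. (\<exists>c. AE t in M. \<bar>f t\<bar> \<le> c) \<longrightarrow> (\<exists>x. AE t in M. J x t = f t))
     \<and> (\<forall>f. integrable M f \<longrightarrow> (\<forall>\<epsilon>>0. \<exists>x. (\<integral>t. \<bar>J x t - f t\<bar> \<partial>M) < \<epsilon>))
     \<and> closure {x. \<exists>c. AE t in M. \<bar>J x t\<bar> \<le> c} = UNIV
     \<and> (\<forall>x c. (AE t in M. \<bar>J x t\<bar> \<le> c) \<longrightarrow>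
            (\<integral>t. \<bar>J x t\<bar> \<partial>M) \<le> norm x \<and> norm x \<le> 2 * c)"

definition supp :: "'w measure \<Rightarrow> ('e \<Rightarrow> 'w \<Rightarrow> real) \<Rightarrow> 'e \<Rightarrow> 'w set" where
  "supp M J x = {t \<in> space M. J x t \<noteq> 0}"

definition disjoint_seq :: "(nat \<Rightarrow> 'e::{lattice,uminus,zero}) \<Rightarrow> bool" where
  "disjoint_seq x \<longleftrightarrow> (\<forall>n m. n \<noteq> m \<longrightarrow> inf (labs (x n)) (labs (x m)) = 0)"

definition infinite_dim :: "'e::real_vector set \<Rightarrow> bool" where
  "infinite_dim W \<longleftrightarrow> \<not> (\<exists>B. finite B \<and> W \<subseteq> span B)"

definition strictly_singular_on :: "('e::real_normed_vector \<Rightarrow> 'y::real_normed_vector) \<Rightarrow> 'e set \<Rightarrow> bool" where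
  "strictly_singular_on T V \<longleftrightarrow>
     \<not> (\<exists>W. subspace W \<and> closed W \<and> W \<subseteq> V \<and> infinite_dim W
            \<and> (\<exists>c>0. \<forall>w\<in>W. c * norm w \<le> norm (T w)))"

definition disj_non_singular :: "('e::{real_normed_vector,lattice} \<Rightarrow> 'y::real_normed_vector) \<Rightarrow> bool" where
  "disj_non_singular T \<longleftrightarrow>
     \<not> (\<exists>x::nat \<Rightarrow> 'e. disjoint_seq x \<and> (\<forall>n. x n \<noteq> 0)
          \<and> strictly_singular_on T (closure (span (range x))))"

end

theory Submission
  imports Defs
begin

text \<open>
  If \<open>T\<close> is bounded below on unit vectors of small support, then it is an isomorphism on the closed
  span of a tail of any disjoint sequence, because the supports of that tail have small union.
  Conversely, if unit vectors \<open>x\<^sub>n\<close> have rapidly decreasing supports and images \<open>T x\<^sub>n\<close>, order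
  continuity (through absolute continuity of the norm) allows them to be perturbed into a disjoint
  sequence \<open>y\<^sub>n\<close> with \<open>T y\<^sub>n\<close> still summable. Coefficients with respect to \<open>y\<^sub>n\<close> are dominated by the
  norm, so on \<open>[y\<^sub>n]\<close> the operator \<open>T\<close> is a norm limit of finite rank operators; an infinite-dimensional
  subspace contains a non-zero vector whose first \<open>N\<close> coefficients vanish, where \<open>T\<close> is
  therefore arbitrarily small.
\<close>

section \<open>Absolute value in an ordered vector lattice\<close>

lemma labs_ge: "x \<le> labs x" "- x \<le> labs x" for x :: "'e::{ordered_real_vector,lattice}"
  by (simp_all add: labs_def)

lemma labs_nonneg: "0 \<le> labs x" for x :: "'e::{ordered_real_vector,lattice}"
proof -
  have "x + (- x) \<le> labs x + labs x"
    by (intro add_mono labs_ge)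
  then have "0 \<le> (1/2::real) *\<^sub>R (labs x + labs x)"
    by (intro scaleR_nonneg_nonneg) simp_all
  also have "\<dots> = labs x"
    by (simp flip: scaleR_add_left add: scaleR_add_right)
  finally show ?thesis .
qed

lemma labs_of_nonneg: "0 \<le> x \<Longrightarrow> labs x = x" for x :: "'e::{ordered_real_vector,lattice}"
  unfolding labs_def by (intro sup_absorb1) (meson neg_le_0_iff_le order.trans)

section \<open>Closures of subspaces and intersections with kernels of functionals\<close>

lemma subspace_closure:
  fixes S :: "'e::real_normed_vector set"
  assumes "subspace S"
  shows "subspace (closure S)"
proof (rule subspaceI)
  show "0 \<in> closure S"
    using assms closure_subset subspace_0 by blast
next
  fix v w assume "v \<in> closure S" "w \<in> closure S"
  then obtain a b where a: "\<And>n. a n \<in> S" "a \<longlonglongrightarrow> v" and b: "\<And>n. b n \<in> S" "b \<longlonglongrightarrow> w"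
    unfolding closure_sequential by auto
  then show "v + w \<in> closure S"
    unfolding closure_sequential using assms
    by (intro exI[of _ "\<lambda>n. a n + b n"]) (auto intro: tendsto_add subspace_add)
next
  fix c v assume "v \<in> closure S"
  then obtain a where a: "\<And>n. a n \<in> S" "a \<longlonglongrightarrow> v"
    unfolding closure_sequential by auto
  then show "c *\<^sub>R v \<in> closure S"
    unfolding closure_sequential using assms
    by (intro exI[of _ "\<lambda>n. c *\<^sub>R a n"]) (auto intro: tendsto_scaleR subspace_scale)
qed

text \<open>A vector of \<open>W\<close> outside the kernel of \<open>f\<close> spans a complement
  of the kernel in \<open>W\<close>, so a finite set whose span contains the kernel part would, with
  this vector added, span \<open>W\<close>.\<close>

lemma infinite_dim_inter_kernel:
  assumes W: "subspace W" "infinite_dim W" and f: "linear f"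
  shows "infinite_dim {w \<in> W. f w = (0::real)}"
  unfolding infinite_dim_def
proof
  assume "\<exists>B. finite B \<and> {w \<in> W. f w = 0} \<subseteq> span B"
  then obtain B where B: "finite B" "{w \<in> W. f w = 0} \<subseteq> span B" by blast
  obtain w0 where w0: "w0 \<in> W" "f w0 \<noteq> 0"
    using B W(2) unfolding infinite_dim_def by blast
  have "W \<subseteq> span (insert w0 B)"
  proof
    fix w assume w: "w \<in> W"
    let ?u = "w - (f w / f w0) *\<^sub>R w0"
    have "?u \<in> W" using W(1) w w0(1) by (simp add: subspace_diff subspace_scale)
    moreover have "f ?u = 0" using w0(2) f by (simp add: linear_diff linear_scale)
    ultimately have "?u \<in> span B" using B by blast
    then show "w \<in> span (insert w0 B)"
      unfolding span_insert by blast
  qed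
  then show False using B(1) W(2) unfolding infinite_dim_def by blast
qed

text \<open>Passing to one kernel at a time preserves infinite dimension. The resulting vector is
  the one on which the first \<open>N\<close> coordinates, and with them a finite-rank part of the
  operator, vanish.\<close>

lemma infinite_dim_common_zero:
  fixes f :: "nat \<Rightarrow> 'e::real_vector \<Rightarrow> real"
  assumes W: "subspace W" "infinite_dim W" and f: "\<And>i. linear (f i)"
  obtains w where "w \<in> W" "w \<noteq> 0" "\<And>i. i < N \<Longrightarrow> f i w = 0"
proof -
  have "subspace {w \<in> W. \<forall>i<N. f i w = 0} \<and> infinite_dim {w \<in> W. \<forall>i<N. f i w = 0}"
  proof (induction N)
    case 0
    then show ?case using W by simp
  next
    case (Suc N)
    have eq: "{w \<in> W. \<forall>i<Suc N. f i w = 0} = {w \<in> {w \<in> W. \<forall>i<N. f i w = 0}. f N w = 0}"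
      by (auto simp: less_Suc_eq)
    have "infinite_dim {w \<in> W. \<forall>i<Suc N. f i w = 0}"
      unfolding eq using Suc f infinite_dim_inter_kernel by blast
    moreover have "subspace {w \<in> W. \<forall>i<Suc N. f i w = 0}"
      using W(1) f by (auto simp: subspace_def linear_add linear_scale linear_0)
    ultimately show ?case by blast
  qed
  then have "\<not> {w \<in> W. \<forall>i<N. f i w = 0} \<subseteq> span {}"
    unfolding infinite_dim_def by blast
  then show ?thesis using that by auto
qed

section \<open>Norm and order of \<open>E\<close> compared with pointwise data of the representing
  functions\<close>

locale koethe_space = prob_space M for M :: "'w measure" +
  fixes J :: "'e::{banach,ordered_real_vector,lattice} \<Rightarrow> 'w \<Rightarrow> real"
  assumes lattice_norm: "labs (x::'e) \<le> labs y \<Longrightarrow> norm x \<le> norm y"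
    and rep: "koethe_rep M J"
begin

lemma J_linear: "linear (\<lambda>x. J x t)"
  using rep by (simp add: koethe_rep_def)

lemma J_simps [simp]:
  "J (x + y) t = J x t + J y t"
  "J (x - y) t = J x t - J y t"
  "J (- x) t = - J x t"
  "J (a *\<^sub>R x) t = a * J x t"
  "J 0 t = 0"
  using linear_add[OF J_linear] linear_diff[OF J_linear] linear_neg[OF J_linear]
    linear_scale[OF J_linear] linear_0[OF J_linear] by auto

lemma J_measurable [measurable]: "J x \<in> borel_measurable M"
  and J_integrable [simp]: "integrable M (J x)"
  using rep by (simp_all add: koethe_rep_def)

lemma le_iff_AE: "x \<le> y \<longleftrightarrow> (AE t in M. J x t \<le> J y t)"
  using rep by (simp add: koethe_rep_def)

lemma eqI_AE: "(AE t in M. J x t = J y t) \<Longrightarrow> x = y"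
  by (intro order.antisym) (auto simp: le_iff_AE)

lemma bounded_represented:
  assumes "f \<in> borel_measurable M" "AE t in M. \<bar>f t\<bar> \<le> c"
  obtains x where "AE t in M. J x t = f t"
proof -
  have "\<forall>f\<in>borel_measurable M. (\<exists>c. AE t in M. \<bar>f t\<bar> \<le> c) \<longrightarrow> (\<exists>x. AE t in M. J x t = f t)"
    using rep by (simp add: koethe_rep_def)
  with assms that show thesis by meson
qed

lemma bounded_dense: "closure {x. \<exists>c. AE t in M. \<bar>J x t\<bar> \<le> c} = UNIV"
  using rep by (simp add: koethe_rep_def)

lemma norm_labs: "norm (labs x) = norm (x::'e)"
  by (intro order.antisym lattice_norm) (simp_all add: labs_of_nonneg labs_nonneg)

lemma norm_mono_nonneg: "0 \<le> x \<Longrightarrow> x \<le> y \<Longrightarrow> norm x \<le> norm (y::'e)"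
  by (intro lattice_norm) (metis labs_of_nonneg order.trans)

lemma abs_J_le_J_labs: "AE t in M. \<bar>J x t\<bar> \<le> J (labs x) t"
proof -
  have "AE t in M. J x t \<le> J (labs x) t" "AE t in M. J (- x) t \<le> J (labs x) t"
    using labs_ge[of x] by (simp_all only: le_iff_AE)
  then show ?thesis by eventually_elim simp
qed

text \<open>The representation compares the \<open>L1\<close> integral with the norm only for
  bounded functions. The truncations \<open>min (J x t) (real n)\<close> are bounded and lie between
  0 and \<open>x\<close>, so the monotone norm bounds their integrals by \<open>norm x\<close>, and
  dominated convergence passes to the limit.\<close>

lemma L1_le_norm_nonneg:
  assumes "0 \<le> x"
  shows "(\<integral>t. J x t \<partial>M) \<le> norm x"
proof -
  have pos: "AE t in M. 0 \<le> J x t"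
    using assms by (simp add: le_iff_AE)
  have trunc: "(\<integral>t. min (J x t) (real n) \<partial>M) \<le> norm x" for n
  proof -
    have bd: "AE t in M. \<bar>min (J x t) (real n)\<bar> \<le> real n"
      using pos by eventually_elim auto
    then obtain y where y: "AE t in M. J y t = min (J x t) (real n)"
      by (rule bounded_represented[rotated]) auto
    have bdy: "AE t in M. \<bar>J y t\<bar> \<le> real n"
      using y bd by eventually_elim auto
    have "0 \<le> y"
      unfolding le_iff_AE using y pos by eventually_elim auto
    moreover have "y \<le> x"
      unfolding le_iff_AE using y by eventually_elim auto
    ultimately have "norm y \<le> norm x" by (rule norm_mono_nonneg)
    moreover have "AE t in M. min (J x t) (real n) = \<bar>J y t\<bar>"
      using y pos by eventually_elim simp
    then have "(\<integral>t. min (J x t) (real n) \<partial>M) = (\<integral>t. \<bar>J y t\<bar> \<partial>M)"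
      by (intro integral_cong_AE) simp_all
    moreover have "(\<integral>t. \<bar>J y t\<bar> \<partial>M) \<le> norm y"
      using rep bdy by (simp add: koethe_rep_def)
    ultimately show ?thesis by simp
  qed
  have "(\<lambda>n. \<integral>t. min (J x t) (real n) \<partial>M) \<longlonglongrightarrow> (\<integral>t. J x t \<partial>M)"
  proof (rule integral_dominated_convergence[where w = "\<lambda>t. \<bar>J x t\<bar>"])
    show "AE t in M. (\<lambda>n. min (J x t) (real n)) \<longlonglongrightarrow> J x t"
    proof (rule AE_I2)
      fix t
      obtain n0 where "J x t \<le> real n0" using real_arch_simple by blast
      then have "\<forall>\<^sub>F n in sequentially. min (J x t) (real n) = J x t"
        by (intro eventually_sequentiallyI[of n0]) (simp add: min_def)
      then show "(\<lambda>n. min (J x t) (real n)) \<longlonglongrightarrow> J x t"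
        by (rule tendsto_eventually)
    qed
    show "AE t in M. norm (min (J x t) (real n)) \<le> \<bar>J x t\<bar>" for n
      using pos by eventually_elim auto
  qed auto
  then show ?thesis
    by (rule LIMSEQ_le_const2) (use trunc in auto)
qed

lemma L1_le_norm: "(\<integral>t. \<bar>J x t\<bar> \<partial>M) \<le> norm x"
proof -
  \<comment> \<open>Only the inequality between the modulus and \<open>J (labs x)\<close> is
    available here; equality rests on restrictions and comes with \<open>J_labs\<close>.\<close>
  have "(\<integral>t. \<bar>J x t\<bar> \<partial>M) \<le> (\<integral>t. J (labs x) t \<partial>M)"
    using abs_J_le_J_labs by (intro integral_mono_AE) auto
  also have "\<dots> \<le> norm x"
    using L1_le_norm_nonneg[OF labs_nonneg] norm_labs by metis
  finally show ?thesis .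
qed

text \<open>\<open>labs x\<close> is a supremum in the order of \<open>E\<close>, which need not a
  priori be computed pointwise. A representative of the pointwise modulus is an upper bound of
  \<open>x\<close> and \<open>- x\<close>, and the least one because \<open>labs x\<close> already
  dominates the modulus almost everywhere.\<close>

lemma labs_eqI_AE:
  assumes "AE t in M. J z t = \<bar>J x t\<bar>"
  shows "labs x = z"
proof (rule order.antisym)
  have "x \<le> z"
    unfolding le_iff_AE using assms by eventually_elim simp
  moreover have "- x \<le> z"
    unfolding le_iff_AE using assms by eventually_elim simp
  ultimately show "labs x \<le> z" by (simp add: labs_def)
  show "z \<le> labs x"
    unfolding le_iff_AE using assms abs_J_le_J_labs[of x] by eventually_elim simp
qed

text \<open>For bounded functions the pointwise moduli have representatives, so pointwise domination
  turns into domination of \<open>labs\<close> and the lattice norm applies. The bounded case comes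
  first because it is used to construct restrictions, on which \<open>norm_mono_AE\<close>
  depends.\<close>

lemma norm_mono_AE_bounded:
  assumes x: "AE t in M. \<bar>J x t\<bar> \<le> c" and y: "AE t in M. \<bar>J y t\<bar> \<le> \<bar>J x t\<bar>"
  shows "norm y \<le> norm x"
proof -
  have "AE t in M. \<bar>\<bar>J x t\<bar>\<bar> \<le> c"
    using x by simp
  then obtain a where a: "AE t in M. J a t = \<bar>J x t\<bar>"
    by (rule bounded_represented[rotated]) auto
  have "AE t in M. \<bar>\<bar>J y t\<bar>\<bar> \<le> c"
    using x y by eventually_elim auto
  then obtain b where b: "AE t in M. J b t = \<bar>J y t\<bar>"
    by (rule bounded_represented[rotated]) auto
  have "b \<le> a"
    unfolding le_iff_AE using a b y by eventually_elim simp
  then show ?thesis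
    using labs_eqI_AE[OF a] labs_eqI_AE[OF b] lattice_norm by simp
qed

text \<open>That E is an ideal of L1 is not part of the representation; closure under restriction is
  recovered from the density of the bounded functions and the completeness of E.\<close>

lemma restriction_exists:
  assumes A [measurable]: "A \<in> sets M"
  obtains y where "AE t in M. J y t = indicator A t * J x t"
proof -
  have "x \<in> closure {x. \<exists>c. AE t in M. \<bar>J x t\<bar> \<le> c}"
    using bounded_dense by simp
  then obtain u where u: "\<And>n. \<exists>c. AE t in M. \<bar>J (u n) t\<bar> \<le> c" and ux: "u \<longlonglongrightarrow> x"
    unfolding closure_sequential by auto
  have "\<exists>v. AE t in M. J v t = indicator A t * J (u n) t" for n
  proof -
    obtain c where "AE t in M. \<bar>J (u n) t\<bar> \<le> c" using u by blast
    then have "AE t in M. \<bar>indicator A t * J (u n) t\<bar> \<le> c"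
      by eventually_elim (auto simp: indicator_def)
    then show ?thesis
      by (rule bounded_represented[rotated]) auto
  qed
  then obtain v where v: "\<And>n. AE t in M. J (v n) t = indicator A t * J (u n) t" by metis
  \<comment> \<open>Restriction to \<open>A\<close> does not increase the norm of bounded functions,
    hence \<open>v\<close> inherits the Cauchy property from \<open>u\<close>.\<close>
  have diff: "norm (v n - v m) \<le> norm (u n - u m)" for n m
  proof -
    obtain c d where c: "AE t in M. \<bar>J (u n) t\<bar> \<le> c" and d: "AE t in M. \<bar>J (u m) t\<bar> \<le> d"
      using u by meson
    show ?thesis
    proof (rule norm_mono_AE_bounded)
      show "AE t in M. \<bar>J (u n - u m) t\<bar> \<le> c + d"
        using c d by eventually_elim auto
      show "AE t in M. \<bar>J (v n - v m) t\<bar> \<le> \<bar>J (u n - u m) t\<bar>"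
        using v[of n] v[of m] by eventually_elim (auto simp: indicator_def)
    qed
  qed
  have "Cauchy v"
  proof (rule metric_CauchyI)
    fix e :: real assume "0 < e"
    then obtain N where "\<forall>m\<ge>N. \<forall>n\<ge>N. dist (u m) (u n) < e"
      using LIMSEQ_imp_Cauchy[OF ux] metric_CauchyD by blast
    then show "\<exists>N. \<forall>m\<ge>N. \<forall>n\<ge>N. dist (v m) (v n) < e"
      using diff by (metis dist_norm order.strict_trans1)
  qed
  then obtain y where vy: "v \<longlonglongrightarrow> y"
    using Cauchy_convergent_iff convergent_def by blast
  \<comment> \<open>The limit is identified in \<open>L1\<close>: the integral of a modulus is at
    most the norm, and restricting to \<open>A\<close> only decreases it.\<close>
  have le: "(\<integral>t. \<bar>J y t - indicator A t * J x t\<bar> \<partial>M) \<le> norm (y - v n) + norm (u n - x)" for n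
  proof -
    have ind: "integrable M (\<lambda>t. indicator A t * J x t)"
      using integrable_mult_indicator[OF A J_integrable[of x]] by simp
    have "(\<integral>t. \<bar>J y t - indicator A t * J x t\<bar> \<partial>M) \<le>
        (\<integral>t. \<bar>J (y - v n) t\<bar> + \<bar>J (u n - x) t\<bar> \<partial>M)"
    proof (intro integral_mono_AE)
      show "AE t in M. \<bar>J y t - indicator A t * J x t\<bar> \<le> \<bar>J (y - v n) t\<bar> + \<bar>J (u n - x) t\<bar>"
        using v[of n] by eventually_elim (auto simp: indicator_def)
      show "integrable M (\<lambda>t. \<bar>J y t - indicator A t * J x t\<bar>)"
        using ind by (intro integrable_abs Bochner_Integration.integrable_diff) auto
    qed (intro Bochner_Integration.integrable_add integrable_abs J_integrable)
    also have "\<dots> = (\<integral>t. \<bar>J (y - v n) t\<bar> \<partial>M) + (\<integral>t. \<bar>J (u n - x) t\<bar> \<partial>M)"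
      by (intro Bochner_Integration.integral_add integrable_abs J_integrable)
    also have "\<dots> \<le> norm (y - v n) + norm (u n - x)"
      by (intro add_mono L1_le_norm)
    finally show ?thesis .
  qed
  have "(\<lambda>n. norm (y - v n) + norm (u n - x)) \<longlonglongrightarrow> norm (y - y) + norm (x - x)"
    by (intro tendsto_intros vy ux)
  then have "(\<integral>t. \<bar>J y t - indicator A t * J x t\<bar> \<partial>M) \<le> 0"
    using LIMSEQ_le_const[of _ 0] le by fastforce
  then have "(\<integral>t. \<bar>J y t - indicator A t * J x t\<bar> \<partial>M) = 0"
    by (intro order.antisym) auto
  moreover have "integrable M (\<lambda>t. \<bar>J y t - indicator A t * J x t\<bar>)"
    using integrable_mult_indicator[OF A J_integrable[of x]]
    by (auto intro!: integrable_abs Bochner_Integration.integrable_diff)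
  ultimately have "AE t in M. \<bar>J y t - indicator A t * J x t\<bar> = 0"
    by (subst (asm) integral_nonneg_eq_0_iff_AE) auto
  then show thesis by (intro that[of y]) auto
qed

lemma J_labs: "AE t in M. J (labs x) t = \<bar>J x t\<bar>"
proof -
  have "{t \<in> space M. 0 \<le> J x t} \<in> sets M" by measurable
  then obtain y where y: "AE t in M. J y t = indicator {t \<in> space M. 0 \<le> J x t} t * J x t"
    using restriction_exists by blast
  \<comment> \<open>\<open>y\<close> is the positive part of \<open>x\<close>, and twice the
    positive part minus \<open>x\<close> is the modulus.\<close>
  have "AE t in M. J (2 *\<^sub>R y - x) t = \<bar>J x t\<bar>"
    using y AE_space by eventually_elim (auto simp: indicator_def)
  then show ?thesis using labs_eqI_AE by metis
qed

lemma norm_mono_AE: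
  assumes "AE t in M. \<bar>J y t\<bar> \<le> \<bar>J x t\<bar>"
  shows "norm y \<le> norm x"
proof (rule lattice_norm)
  show "labs y \<le> labs x"
    unfolding le_iff_AE using assms J_labs[of x] J_labs[of y] by eventually_elim simp
qed

lemma disjoint_iff_AE: "inf (labs x) (labs y) = 0 \<longleftrightarrow> (AE t in M. J x t = 0 \<or> J y t = 0)"
proof
  assume inf: "inf (labs x) (labs y) = 0"
  \<comment> \<open>Capping at 1 makes the minimum of the moduli bounded, hence representable,
    without changing where it is zero.\<close>
  obtain z where z: "AE t in M. J z t = min 1 (min \<bar>J x t\<bar> \<bar>J y t\<bar>)"
    by (rule bounded_represented[of "\<lambda>t. min 1 (min \<bar>J x t\<bar> \<bar>J y t\<bar>)" 1]) auto
  have "z \<le> labs x"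
    unfolding le_iff_AE using z J_labs[of x] by eventually_elim (simp add: min_le_iff_disj)
  moreover have "z \<le> labs y"
    unfolding le_iff_AE using z J_labs[of y] by eventually_elim (simp add: min_le_iff_disj)
  ultimately have "z \<le> 0" using inf by (metis le_inf_iff)
  then have "AE t in M. J z t \<le> 0" by (simp add: le_iff_AE)
  with z show "AE t in M. J x t = 0 \<or> J y t = 0"
    by eventually_elim (auto simp: min_def split: if_splits)
next
  assume dj: "AE t in M. J x t = 0 \<or> J y t = 0"
  have "inf (labs x) (labs y) \<le> labs x" "inf (labs x) (labs y) \<le> labs y" by simp_all
  then have "AE t in M. J (inf (labs x) (labs y)) t \<le> J (labs x) t"
    "AE t in M. J (inf (labs x) (labs y)) t \<le> J (labs y) t" by (simp_all add: le_iff_AE)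
  then have "AE t in M. J (inf (labs x) (labs y)) t \<le> J 0 t"
    using J_labs[of x] J_labs[of y] dj by eventually_elim auto
  then have "inf (labs x) (labs y) \<le> 0" by (simp add: le_iff_AE)
  then show "inf (labs x) (labs y) = 0"
    by (intro order.antisym) (simp_all add: labs_nonneg)
qed

section \<open>Absolute continuity of the norm\<close>

text \<open>Otherwise there are sets \<open>A n\<close> of probability below \<open>(1/2)^n\<close>
  whose indicators keep norm at least \<open>\<epsilon>\<close>. The indicators of the tail unions
  \<open>B k\<close> decrease to 0 in order, so order continuity makes their norms small, while
  \<open>A k \<subseteq> B k\<close> keeps them large.\<close>

lemma norm_absolutely_continuous_indicator:
  assumes oc: "order_continuous TYPE('e)" and \<epsilon>: "0 < \<epsilon>"
  obtains \<delta> where "0 < \<delta>"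
    "\<And>A e. A \<in> sets M \<Longrightarrow> prob A < \<delta> \<Longrightarrow> (AE t in M. J e t = indicator A t) \<Longrightarrow> norm e < \<epsilon>"
proof (rule ccontr)
  assume neg: "\<not> thesis"
  have "\<exists>A e. A \<in> sets M \<and> prob A < (1/2)^n \<and> (AE t in M. J e t = indicator A t) \<and> \<epsilon> \<le> norm e"
    for n :: nat
  proof (rule ccontr)
    assume "\<nexists>A e. A \<in> sets M \<and> prob A < (1/2)^n \<and> (AE t in M. J e t = indicator A t) \<and> \<epsilon> \<le> norm e"
    then show False
      using neg that[of "(1/2)^n"] by (meson not_le_imp_less zero_less_power half_gt_zero zero_less_one)
  qed
  then obtain A a where A: "\<And>n. A n \<in> sets M" "\<And>n. prob (A n) < (1/2)^n"
    and a: "\<And>n. AE t in M. J (a n) t = indicator (A n) t" "\<And>n. \<epsilon> \<le> norm (a n)"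
    by metis
  define B where "B k = (\<Union>j\<in>{k..}. A j)" for k
  have [measurable]: "B k \<in> sets M" for k
    unfolding B_def using A(1) by blast
  have "\<exists>e. AE t in M. J e t = indicator (B k) t" for k
    by (rule bounded_represented[of "indicator (B k)" 1]) (auto intro: exI)
  then obtain b where b: "\<And>k. AE t in M. J (b k) t = indicator (B k) t" by metis
  have b_mono: "b k \<le> b j" if "j \<le> k" for j k
  proof -
    have sub: "B k \<subseteq> B j" using that by (force simp: B_def)
    show ?thesis
      unfolding le_iff_AE using b[of j] b[of k]
      by eventually_elim (use sub in \<open>auto simp: indicator_def\<close>)
  qed
  have b_nonneg: "0 \<le> b k" for k
    unfolding le_iff_AE using b[of k] by eventually_elim simp
  \<comment> \<open>By Borel-Cantelli almost every point lies outside \<open>B k\<close> for some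
    \<open>k\<close>, so a common lower bound of the \<open>b k\<close> is nonpositive almost
    everywhere.\<close>
  have b_inf: "z \<le> 0" if z: "\<And>k. z \<le> b k" for z
  proof -
    have "summable (\<lambda>n. prob (A n))"
      by (rule summable_comparison_test'[OF summable_geometric[of "1/2::real"]])
        (use A(2) in \<open>auto intro: less_imp_le\<close>)
    then have ev: "AE t in M. \<forall>\<^sub>F n in sequentially. t \<in> space M - A n"
      using A(1) by (intro borel_cantelli_AE1) (auto simp: emeasure_eq_measure)
    have "AE t in M. \<forall>k. J z t \<le> J (b k) t"
      using z by (simp add: AE_all_countable le_iff_AE)
    moreover have "AE t in M. \<forall>k. J (b k) t = indicator (B k) t"
      using b by (simp add: AE_all_countable)
    ultimately have "AE t in M. J z t \<le> J 0 t"
      using ev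
    proof eventually_elim
      case (elim t)
      then obtain k where "t \<notin> B k"
        by (auto simp: eventually_sequentially B_def)
      then show ?case using elim by (metis J_simps(5) indicator_simps(2))
    qed
    then show ?thesis by (simp add: le_iff_AE)
  qed
  have "\<exists>d0\<in>range b. \<forall>d\<in>range b. d \<le> d0 \<longrightarrow> norm d < \<epsilon>"
  proof -
    have "\<exists>c\<in>range b. c \<le> b i \<and> c \<le> b j" for i j
      using b_mono[of i "max i j"] b_mono[of j "max i j"] by auto
    then have "range b \<noteq> {} \<and> (\<forall>p\<in>range b. \<forall>q\<in>range b. \<exists>c\<in>range b. c \<le> p \<and> c \<le> q)
        \<and> (\<forall>d\<in>range b. 0 \<le> d) \<and> (\<forall>z. (\<forall>d\<in>range b. z \<le> d) \<longrightarrow> z \<le> 0)"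
      using b_nonneg b_inf by auto
    then show ?thesis
      using oc[unfolded order_continuous_def, rule_format, of "range b" \<epsilon>] \<epsilon> by blast
  qed
  then obtain k where "norm (b k) < \<epsilon>" by blast
  moreover have "norm (a k) \<le> norm (b k)"
  proof (rule norm_mono_AE)
    have sub: "A k \<subseteq> B k" by (auto simp: B_def)
    show "AE t in M. \<bar>J (a k) t\<bar> \<le> \<bar>J (b k) t\<bar>"
      using a(1)[of k] b[of k] by eventually_elim (use sub in \<open>auto simp: indicator_def\<close>)
  qed
  ultimately show False using a(2)[of k] by simp
qed

text \<open>A bounded \<open>u\<close> close to \<open>x\<close> reduces the claim to indicators:
  restricted to \<open>A\<close>, the function \<open>u\<close> is dominated by a multiple of the
  indicator, and the restriction of \<open>u - x\<close> has norm at most that of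
  \<open>u - x\<close>.\<close>

lemma norm_absolutely_continuous:
  assumes oc: "order_continuous TYPE('e)" and \<epsilon>: "0 < \<epsilon>"
  obtains \<delta> where "0 < \<delta>"
    "\<And>A y. A \<in> sets M \<Longrightarrow> prob A < \<delta> \<Longrightarrow> (AE t in M. J y t = indicator A t * J x t) \<Longrightarrow> norm y < \<epsilon>"
proof -
  have "x \<in> closure {x. \<exists>c. AE t in M. \<bar>J x t\<bar> \<le> c}"
    using bounded_dense by simp
  then have "\<exists>u\<in>{x. \<exists>c. AE t in M. \<bar>J x t\<bar> \<le> c}. dist u x < \<epsilon> / 2"
    unfolding closure_approachable using half_gt_zero[OF \<epsilon>] by iprover
  then obtain u c where u: "AE t in M. \<bar>J u t\<bar> \<le> c" "norm (u - x) < \<epsilon> / 2"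
    unfolding dist_norm by blast
  \<comment> \<open>The bound \<open>c\<close> may be 0; a strictly positive one can serve as a
    divisor.\<close>
  define c' where "c' = \<bar>c\<bar> + 1"
  have c': "0 < c'" "AE t in M. \<bar>J u t\<bar> \<le> c'"
    using u(1) by (auto simp: c'_def elim!: eventually_mono)
  obtain \<delta> where \<delta>: "0 < \<delta>"
    "\<And>A e. A \<in> sets M \<Longrightarrow> prob A < \<delta> \<Longrightarrow> (AE t in M. J e t = indicator A t) \<Longrightarrow> norm e < \<epsilon> / 2 / c'"
    using norm_absolutely_continuous_indicator[OF oc, of "\<epsilon> / 2 / c'"] \<epsilon> c'(1) by auto
  show thesis
  proof (rule that[OF \<delta>(1)])
    fix A y assume A: "A \<in> sets M" "prob A < \<delta>" and y: "AE t in M. J y t = indicator A t * J x t"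
    obtain e where e: "AE t in M. J e t = indicator A t"
      by (rule bounded_represented[of "indicator A" 1]) (use A in \<open>auto simp: indicator_def\<close>)
    obtain v where v: "AE t in M. J v t = indicator A t * J u t"
      using restriction_exists A(1) by blast
    have "norm v \<le> norm (c' *\<^sub>R e)"
      using v e c'(2) by (intro norm_mono_AE, eventually_elim) (auto simp: indicator_def)
    also have "\<dots> < \<epsilon> / 2"
      using \<delta>(2)[OF A e] c'(1) by (simp add: field_simps)
    finally have "norm v < \<epsilon> / 2" .
    moreover have "norm (v - y) \<le> norm (u - x)"
      using v y by (intro norm_mono_AE, eventually_elim) (auto simp: indicator_def)
    then have "norm (v - y) < \<epsilon> / 2" using u(2) by simp
    moreover have "norm y \<le> norm v + norm (v - y)"
      by (metis norm_triangle_sub norm_minus_commute)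
    ultimately show "norm y < \<epsilon>" by simp
  qed
qed

section \<open>Disjoint sequences: coordinate functionals and strict singularity on closed
  spans\<close>

lemma L1_pos:
  assumes "x \<noteq> 0"
  shows "0 < (\<integral>t. \<bar>J x t\<bar> \<partial>M)"
proof -
  have "(\<integral>t. \<bar>J x t\<bar> \<partial>M) \<noteq> 0"
  proof
    assume "(\<integral>t. \<bar>J x t\<bar> \<partial>M) = 0"
    then have "AE t in M. \<bar>J x t\<bar> = 0"
      by (subst (asm) integral_nonneg_eq_0_iff_AE) auto
    then have "x = 0" by (intro eqI_AE) simp
    then show False using assms by simp
  qed
  moreover have "0 \<le> (\<integral>t. \<bar>J x t\<bar> \<partial>M)" by simp
  ultimately show ?thesis by linarith
qed

text \<open>A sign has modulus at most 1, so the pairing is bounded by the \<open>L1\<close> norm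
  and hence by the norm of \<open>E\<close>. The constant \<open>c\<close> is later the integral of
  \<open>\<bar>J y t\<bar>\<close>, which normalises the value at \<open>y\<close> to 1.\<close>

lemma bounded_linear_sgn_pairing: "bounded_linear (\<lambda>v. (\<integral>t. sgn (J y t) * J v t \<partial>M) / c)"
proof (rule bounded_linear_intro)
  have int: "integrable M (\<lambda>t. sgn (J y t) * J v t)" for v
    by (rule Bochner_Integration.integrable_bound[OF J_integrable[of v]]) (auto simp: abs_mult abs_sgn_eq)
  show "(\<integral>t. sgn (J y t) * J (v + w) t \<partial>M) / c =
      (\<integral>t. sgn (J y t) * J v t \<partial>M) / c + (\<integral>t. sgn (J y t) * J w t \<partial>M) / c" for v w
    using int[of v] int[of w] by (simp add: distrib_left add_divide_distrib)
  show "(\<integral>t. sgn (J y t) * J (a *\<^sub>R v) t \<partial>M) / c = a *\<^sub>R ((\<integral>t. sgn (J y t) * J v t \<partial>M) / c)" for a v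
    by (simp add: mult.left_commute)
  show "norm ((\<integral>t. sgn (J y t) * J v t \<partial>M) / c) \<le> norm v * (1 / \<bar>c\<bar>)" for v
  proof -
    have "\<bar>\<integral>t. sgn (J y t) * J v t \<partial>M\<bar> \<le> (\<integral>t. \<bar>sgn (J y t) * J v t\<bar> \<partial>M)"
      by (rule integral_abs_bound)
    also have "\<dots> \<le> (\<integral>t. \<bar>J v t\<bar> \<partial>M)"
      by (intro integral_mono integrable_abs int J_integrable) (auto simp: abs_mult abs_sgn_eq)
    also have "\<dots> \<le> norm v" by (rule L1_le_norm)
    finally show ?thesis by (simp add: divide_right_mono)
  qed
qed

text \<open>\<open>\<phi> i\<close> integrates against the sign of \<open>y i\<close> and divides by
  the \<open>L1\<close> norm of \<open>y i\<close>. On the support of \<open>y i\<close> every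
  vector of the span equals its \<open>i\<close>-th term almost everywhere, so that term is
  dominated pointwise by the whole vector and the lattice norm gives the third property.\<close>

lemma coordinate_functionals:
  fixes y :: "nat \<Rightarrow> 'e"
  assumes dj: "disjoint_seq y" and nz: "\<And>n. y n \<noteq> 0"
  obtains \<phi> :: "nat \<Rightarrow> 'e \<Rightarrow> real" where "\<And>i. bounded_linear (\<phi> i)"
    "\<And>i j. \<phi> i (y j) = (if i = j then 1 else 0)"
    "\<And>i v. v \<in> span (range y) \<Longrightarrow> \<bar>\<phi> i v\<bar> * norm (y i) \<le> norm v"
proof -
  define \<phi> where "\<phi> i v = (\<integral>t. sgn (J (y i) t) * J v t \<partial>M) / (\<integral>t. \<bar>J (y i) t\<bar> \<partial>M)" for i v
  have bl: "bounded_linear (\<phi> i)" for i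
    unfolding \<phi>_def by (rule bounded_linear_sgn_pairing)
  have disj: "AE t in M. J (y i) t = 0 \<or> J (y j) t = 0" if "i \<noteq> j" for i j
    using dj that by (simp add: disjoint_seq_def disjoint_iff_AE)
  have delta: "\<phi> i (y j) = (if i = j then 1 else 0)" for i j
  proof (cases "i = j")
    case True
    have "sgn (J (y j) t) * J (y j) t = \<bar>J (y j) t\<bar>" for t
      by (simp add: abs_sgn mult.commute)
    then show ?thesis using L1_pos[OF nz[of j]] True by (simp add: \<phi>_def)
  next
    case False
    have "(\<integral>t. sgn (J (y i) t) * J (y j) t \<partial>M) = (\<integral>t. 0 \<partial>M)"
      using disj[OF False] by (intro integral_cong_AE) auto
    then show ?thesis using False by (simp add: \<phi>_def)
  qed
  have coord: "AE t in M. J (y i) t \<noteq> 0 \<longrightarrow> J v t = \<phi> i v * J (y i) t"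
    if "v \<in> span (range y)" for i v
    using that
  proof (induction rule: span_induct)
    case base
    show "subspace {v. AE t in M. J (y i) t \<noteq> 0 \<longrightarrow> J v t = \<phi> i v * J (y i) t}"
    proof (rule subspaceI)
      show "0 \<in> {v. AE t in M. J (y i) t \<noteq> 0 \<longrightarrow> J v t = \<phi> i v * J (y i) t}"
        using linear_0[OF bounded_linear.linear[OF bl]] by simp
      show "v + w \<in> {v. AE t in M. J (y i) t \<noteq> 0 \<longrightarrow> J v t = \<phi> i v * J (y i) t}"
        if "v \<in> {v. AE t in M. J (y i) t \<noteq> 0 \<longrightarrow> J v t = \<phi> i v * J (y i) t}"
          "w \<in> {v. AE t in M. J (y i) t \<noteq> 0 \<longrightarrow> J v t = \<phi> i v * J (y i) t}" for v w
      proof -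
        have "AE t in M. J (y i) t \<noteq> 0 \<longrightarrow> J v t = \<phi> i v * J (y i) t"
          "AE t in M. J (y i) t \<noteq> 0 \<longrightarrow> J w t = \<phi> i w * J (y i) t" using that by auto
        then have "AE t in M. J (y i) t \<noteq> 0 \<longrightarrow> J (v + w) t = \<phi> i (v + w) * J (y i) t"
          by eventually_elim (simp add: linear_add[OF bounded_linear.linear[OF bl]] distrib_right)
        then show ?thesis by simp
      qed
      show "a *\<^sub>R v \<in> {v. AE t in M. J (y i) t \<noteq> 0 \<longrightarrow> J v t = \<phi> i v * J (y i) t}"
        if "v \<in> {v. AE t in M. J (y i) t \<noteq> 0 \<longrightarrow> J v t = \<phi> i v * J (y i) t}" for a v
      proof -
        have "AE t in M. J (y i) t \<noteq> 0 \<longrightarrow> J v t = \<phi> i v * J (y i) t" using that by auto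
        then have "AE t in M. J (y i) t \<noteq> 0 \<longrightarrow> J (a *\<^sub>R v) t = \<phi> i (a *\<^sub>R v) * J (y i) t"
          by eventually_elim (simp add: linear_scale[OF bounded_linear.linear[OF bl]])
        then show ?thesis by simp
      qed
    qed
  next
    case (step v)
    then obtain j where j: "v = y j" by blast
    show ?case
    proof (cases "i = j")
      case True
      then show ?thesis using j delta by simp
    next
      case False
      show ?thesis
        unfolding j using disj[OF False] by eventually_elim (auto simp: delta False)
    qed
  qed
  show thesis
  proof (rule that[OF bl delta])
    fix i v assume "v \<in> span (range y)"
    then have "AE t in M. \<bar>J (\<phi> i v *\<^sub>R y i) t\<bar> \<le> \<bar>J v t\<bar>"
      using coord[of v i] by (auto elim!: eventually_mono)
    then have "norm (\<phi> i v *\<^sub>R y i) \<le> norm v" by (rule norm_mono_AE)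
    then show "\<bar>\<phi> i v\<bar> * norm (y i) \<le> norm v" by simp
  qed
qed

text \<open>Smallness of \<open>T (y n)\<close> is measured relative to \<open>norm (y n)\<close> to
  match the coordinate estimate: the \<open>i\<close>-th term of \<open>v\<close> then contributes
  at most \<open>C * (1/2)^i * norm v\<close> to the image, which is summable over
  \<open>i\<close>.\<close>

lemma strictly_singular_on_disjoint_span:
  fixes T :: "'e \<Rightarrow> 'y::real_normed_vector"
  assumes T: "bounded_linear T" and dj: "disjoint_seq y" and nz: "\<And>n. y n \<noteq> 0"
    and small: "\<And>n. norm (T (y n)) \<le> C * (1/2)^n * norm (y n)" and C: "0 \<le> C"
  shows "strictly_singular_on T (closure (span (range y)))"
  unfolding strictly_singular_on_def
proof
  assume "\<exists>W. subspace W \<and> closed W \<and> W \<subseteq> closure (span (range y)) \<and> infinite_dim W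
            \<and> (\<exists>c>0. \<forall>w\<in>W. c * norm w \<le> norm (T w))"
  then obtain W c where W: "subspace W" "W \<subseteq> closure (span (range y))" "infinite_dim W"
    and c: "0 < c" "\<And>w. w \<in> W \<Longrightarrow> c * norm w \<le> norm (T w)" by blast
  interpret T: bounded_linear T by fact
  obtain \<phi> :: "nat \<Rightarrow> 'e \<Rightarrow> real" where bl: "\<And>i. bounded_linear (\<phi> i)"
    and delta: "\<And>i j. \<phi> i (y j) = (if i = j then 1 else 0)"
    and bd: "\<And>i v. v \<in> span (range y) \<Longrightarrow> \<bar>\<phi> i v\<bar> * norm (y i) \<le> norm v"
    using coordinate_functionals[OF dj nz] by blast
  have lin: "linear (\<phi> i)" for i using bl bounded_linear.linear by blast
  \<comment> \<open>A vector of the span uses finitely many \<open>y j\<close> and its later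
    coordinates vanish. Asking for all \<open>n\<close> beyond a threshold makes the property stable
    under addition.\<close>
  have expand: "\<exists>n0. \<forall>n\<ge>n0. v = (\<Sum>i<n. \<phi> i v *\<^sub>R y i)" if "v \<in> span (range y)" for v
    using that
  proof (induction rule: span_induct)
    case base
    show "subspace {v. \<exists>n0. \<forall>n\<ge>n0. v = (\<Sum>i<n. \<phi> i v *\<^sub>R y i)}"
    proof (rule subspaceI; clarify)
      show "\<exists>n0. \<forall>n\<ge>n0. 0 = (\<Sum>i<n. \<phi> i 0 *\<^sub>R y i)"
        by (simp add: linear_0[OF lin])
      show "\<exists>n0. \<forall>n\<ge>n0. v + w = (\<Sum>i<n. \<phi> i (v + w) *\<^sub>R y i)"
        if "\<forall>n\<ge>n1. v = (\<Sum>i<n. \<phi> i v *\<^sub>R y i)" "\<forall>n\<ge>n2. w = (\<Sum>i<n. \<phi> i w *\<^sub>R y i)"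
        for v w n1 n2
        using that by (intro exI[of _ "max n1 n2"])
          (simp add: linear_add[OF lin] scaleR_add_left sum.distrib flip: that)
      show "\<exists>n0. \<forall>n\<ge>n0. a *\<^sub>R v = (\<Sum>i<n. \<phi> i (a *\<^sub>R v) *\<^sub>R y i)"
        if "\<forall>n\<ge>n1. v = (\<Sum>i<n. \<phi> i v *\<^sub>R y i)" for a v n1
        using that by (intro exI[of _ n1])
          (simp add: linear_scale[OF lin] flip: scaleR_scaleR scaleR_sum_right)
    qed
  next
    case (step v)
    then obtain j where j: "v = y j" by blast
    have "y j = (\<Sum>i<n. \<phi> i (y j) *\<^sub>R y i)" if "Suc j \<le> n" for n
    proof -
      have "(\<Sum>i<n. \<phi> i (y j) *\<^sub>R y i) = (\<Sum>i<n. if i = j then y i else 0)"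
        by (intro sum.cong) (auto simp: delta)
      then show ?thesis using that by simp
    qed
    then show ?case unfolding j by blast
  qed
  have geom: "(\<Sum>i=N..<n. (1/2::real)^i) \<le> 2 * (1/2)^N" for N n :: nat
  proof -
    have "N \<le> n \<Longrightarrow> (\<Sum>i=N..<n. (1/2::real)^i) = 2 * (1/2)^N - 2 * (1/2)^n"
      by (induction n rule: dec_induct) simp_all
    then show ?thesis by (cases "N \<le> n") simp_all
  qed
  have tail_span: "norm (T (v - (\<Sum>i<N. \<phi> i v *\<^sub>R y i))) \<le> 2 * C * (1/2)^N * norm v"
    if v: "v \<in> span (range y)" for v N
  proof -
    obtain n0 where n0: "\<forall>n\<ge>n0. v = (\<Sum>i<n. \<phi> i v *\<^sub>R y i)" using expand[OF v] by blast
    define n where "n = max n0 N"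
    have "v - (\<Sum>i<N. \<phi> i v *\<^sub>R y i) = (\<Sum>i<n. \<phi> i v *\<^sub>R y i) - (\<Sum>i<N. \<phi> i v *\<^sub>R y i)"
      using n0 by (metis max.cobounded1 n_def)
    also have "\<dots> = (\<Sum>i=N..<n. \<phi> i v *\<^sub>R y i)"
      using sum_diff_nat_ivl[of 0 N n "\<lambda>i. \<phi> i v *\<^sub>R y i"] by (simp add: n_def atLeast0LessThan)
    finally have "norm (T (v - (\<Sum>i<N. \<phi> i v *\<^sub>R y i))) = norm (\<Sum>i=N..<n. \<phi> i v *\<^sub>R T (y i))"
      by (simp add: T.sum T.scaleR)
    also have "\<dots> \<le> (\<Sum>i=N..<n. norm v * (C * (1/2)^i))"
    proof (rule sum_norm_le)
      fix i
      have "norm (\<phi> i v *\<^sub>R T (y i)) \<le> \<bar>\<phi> i v\<bar> * (C * (1/2)^i * norm (y i))"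
        using small[of i] by (simp add: mult_left_mono)
      also have "\<dots> = (\<bar>\<phi> i v\<bar> * norm (y i)) * (C * (1/2)^i)" by simp
      also have "\<dots> \<le> norm v * (C * (1/2)^i)"
        using bd[OF v] C by (intro mult_right_mono) auto
      finally show "norm (\<phi> i v *\<^sub>R T (y i)) \<le> norm v * (C * (1/2)^i)" .
    qed
    also have "\<dots> = norm v * C * (\<Sum>i=N..<n. (1/2)^i)"
      by (simp add: sum_distrib_left mult.assoc)
    also have "\<dots> \<le> norm v * C * (2 * (1/2)^N)"
      using geom C by (intro mult_left_mono) auto
    finally show ?thesis by (simp add: mult_ac)
  qed
  have tail: "norm (T (v - (\<Sum>i<N. \<phi> i v *\<^sub>R y i))) \<le> 2 * C * (1/2)^N * norm v"
    if v: "v \<in> closure (span (range y))" for v N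
  proof -
    \<comment> \<open>Both sides are continuous in \<open>v\<close>, so the estimate extends from
      the span to its closure.\<close>
    have "closed {v. norm (T (v - (\<Sum>i<N. \<phi> i v *\<^sub>R y i))) \<le> 2 * C * (1/2)^N * norm v}"
      by (intro closed_Collect_le continuous_intros T.continuous_on bounded_linear.continuous_on[OF bl])
    then have "closure (span (range y)) \<subseteq>
        {v. norm (T (v - (\<Sum>i<N. \<phi> i v *\<^sub>R y i))) \<le> 2 * C * (1/2)^N * norm v}"
      using tail_span by (intro closure_minimal) blast+
    then show ?thesis using v by blast
  qed
  have "(\<lambda>N. 2 * C * (1/2)^N) \<longlonglongrightarrow> 2 * C * 0"
    by (intro tendsto_intros LIMSEQ_power_zero) simp
  then have "\<forall>\<^sub>F N in sequentially. 2 * C * (1/2)^N < c"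
    using c(1) by (intro order_tendstoD(2)) auto
  then obtain N where N: "2 * C * (1/2)^N < c"
    by (auto simp: eventually_sequentially)
  obtain w where w: "w \<in> W" "w \<noteq> 0" "\<And>i. i < N \<Longrightarrow> \<phi> i w = 0"
    using infinite_dim_common_zero[of W \<phi> N, OF W(1) W(3) lin] by blast
  have "(\<Sum>i<N. \<phi> i w *\<^sub>R y i) = 0"
    using w(3) by simp
  then have "norm (T w) \<le> 2 * C * (1/2)^N * norm w"
    using tail[of w N] w(1) W(2) by auto
  also have "\<dots> < c * norm w"
    using N w(2) by simp
  finally show False using c(2)[OF w(1)] by simp
qed

lemma supp_sets [measurable]: "supp M J x \<in> sets M"
  unfolding supp_def by measurable

lemma disjoint_seq_tail_supports_small:
  assumes dj: "disjoint_seq x" and r: "0 < r"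
  obtains N where "prob (\<Union>n\<in>{N..}. supp M J (x n)) < r"
proof -
  define B where "B N = (\<Union>n\<in>{N..}. supp M J (x n))" for N :: nat
  have B [measurable]: "B N \<in> sets M" for N
    unfolding B_def by (intro sets.countable_UN') auto
  have "decseq B"
    unfolding decseq_def B_def by force
  then have lim: "(\<lambda>N. prob (B N)) \<longlonglongrightarrow> prob (\<Inter>N. B N)"
    using B by (intro finite_Lim_measure_decseq) auto
  have "AE t in M. \<forall>i j. i \<noteq> j \<longrightarrow> J (x i) t = 0 \<or> J (x j) t = 0"
    using dj by (simp add: AE_all_countable disjoint_seq_def disjoint_iff_AE)
  then have "AE t in M. t \<notin> (\<Inter>N. B N)"
  proof eventually_elim
    case (elim t)
    show ?case
    proof
      assume t: "t \<in> (\<Inter>N. B N)"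
      then obtain n where n: "t \<in> supp M J (x n)" by (auto simp: B_def)
      from t have "t \<in> B (Suc n)" by blast
      then obtain m where "Suc n \<le> m" "t \<in> supp M J (x m)" by (auto simp: B_def)
      then have "n \<noteq> m" "J (x n) t \<noteq> 0" "J (x m) t \<noteq> 0" using n by (auto simp: supp_def)
      then show False using elim by blast
    qed
  qed
  then have "prob (\<Inter>N. B N) = 0"
    by (subst prob_eq_0) auto
  then have "\<forall>\<^sub>F N in sequentially. prob (B N) < r"
    using lim r by (intro order_tendstoD(2)) auto
  then show thesis
    using that by (auto simp: eventually_sequentially B_def)
qed

lemma closure_span_supported:
  assumes B [measurable]: "B \<in> sets M" and X: "\<And>x. x \<in> X \<Longrightarrow> supp M J x \<subseteq> B"
    and w: "w \<in> closure (span X)"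
  shows "prob (supp M J w) \<le> prob B"
proof -
  have int: "integrable M (\<lambda>t. indicator (space M - B) t * \<bar>J v t\<bar>)" for v
    using integrable_mult_indicator[of "space M - B" M "\<lambda>t. \<bar>J v t\<bar>"] by simp
  have span: "J v t = 0" if "t \<in> space M - B" "v \<in> span X" for v t
    using that(2)
  proof (induction rule: span_induct)
    case base
    show "subspace {v. J v t = 0}" by (auto simp: subspace_def)
  next
    case (step v)
    then show ?case using X that(1) by (auto simp: supp_def)
  qed
  obtain v where v: "\<And>n. v n \<in> span X" "v \<longlonglongrightarrow> w"
    using w unfolding closure_sequential by auto
  have le: "(\<integral>t. indicator (space M - B) t * \<bar>J w t\<bar> \<partial>M) \<le> norm (w - v n)" for n
  proof -
    have "(\<integral>t. indicator (space M - B) t * \<bar>J w t\<bar> \<partial>M) \<le> (\<integral>t. \<bar>J (w - v n) t\<bar> \<partial>M)"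
      using int span[OF _ v(1)[of n]]
      by (intro integral_mono integrable_abs J_integrable) (auto simp: indicator_def)
    also have "\<dots> \<le> norm (w - v n)" by (rule L1_le_norm)
    finally show ?thesis .
  qed
  have "(\<lambda>n. norm (w - v n)) \<longlonglongrightarrow> norm (w - w)"
    by (intro tendsto_intros v(2))
  then have "(\<integral>t. indicator (space M - B) t * \<bar>J w t\<bar> \<partial>M) \<le> norm (w - w)"
    by (rule LIMSEQ_le_const) (use le in blast)
  moreover have "0 \<le> (\<integral>t. indicator (space M - B) t * \<bar>J w t\<bar> \<partial>M)"
    by simp
  ultimately have "(\<integral>t. indicator (space M - B) t * \<bar>J w t\<bar> \<partial>M) = 0" by simp
  then have "AE t in M. indicator (space M - B) t * \<bar>J w t\<bar> = 0"
    using int by (subst (asm) integral_nonneg_eq_0_iff_AE) auto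
  then have "AE t in M. t \<in> supp M J w \<longrightarrow> t \<in> B"
    by eventually_elim (auto simp: supp_def indicator_def split: if_splits)
  then show ?thesis
    by (rule finite_measure_mono_AE) fact
qed

lemma infinite_dim_disjoint:
  fixes y :: "nat \<Rightarrow> 'e"
  assumes dj: "disjoint_seq y" and nz: "\<And>n. y n \<noteq> 0" and W: "y ` {N..} \<subseteq> W"
  shows "infinite_dim W"
proof -
  obtain \<phi> :: "nat \<Rightarrow> 'e \<Rightarrow> real" where bl: "\<And>i. bounded_linear (\<phi> i)"
    and delta: "\<And>i j. \<phi> i (y j) = (if i = j then 1 else 0)"
    and "\<And>i v. v \<in> span (range y) \<Longrightarrow> \<bar>\<phi> i v\<bar> * norm (y i) \<le> norm v"
    using coordinate_functionals[OF dj nz] by blast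
  have lin: "linear (\<phi> i)" for i using bl bounded_linear.linear by blast
  have inj: "inj y"
    by (rule injI) (metis delta zero_neq_one)
  have "independent (y ` {N..})"
    unfolding dependent_def
  proof clarify
    fix n assume "y n \<in> span (y ` {N..} - {y n})"
    then have "\<phi> n (y n) = 0"
    proof (induction rule: span_induct)
      case base
      show "subspace {v. \<phi> n v = 0}"
        using lin[of n] by (auto simp: subspace_def linear_add linear_scale linear_0)
    next
      case (step v)
      then show ?case using delta by auto
    qed
    then show False using delta by simp
  qed
  moreover have "infinite (y ` {N..})"
    using inj by (simp add: finite_image_iff inj_on_subset infinite_Ici)
  ultimately show ?thesis
    unfolding infinite_dim_def using independent_span_bound W by (meson order.trans)
qed

lemma disj_non_singular_if_bounded_below:
  assumes T: "bounded_linear T" and r: "0 < r"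
    and below: "\<And>x. norm x = 1 \<Longrightarrow> prob (supp M J x) < r \<Longrightarrow> r < norm (T x)"
  shows "disj_non_singular T"
  unfolding disj_non_singular_def
proof clarify
  fix x :: "nat \<Rightarrow> 'e"
  assume dj: "disjoint_seq x" and nz: "\<forall>n. x n \<noteq> 0"
    and ss: "strictly_singular_on T (closure (span (range x)))"
  interpret T: bounded_linear T by fact
  obtain N where N: "prob (\<Union>n\<in>{N..}. supp M J (x n)) < r"
    using disjoint_seq_tail_supports_small[OF dj r] .
  define W where "W = closure (span (x ` {N..}))"
  have "subspace W"
    unfolding W_def by (intro subspace_closure subspace_span)
  moreover have "closed W" "W \<subseteq> closure (span (range x))"
    unfolding W_def by (auto intro!: closure_mono span_mono)
  moreover have "x ` {N..} \<subseteq> W"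
    unfolding W_def by (rule order.trans[OF span_superset closure_subset])
  then have "infinite_dim W"
    using nz by (intro infinite_dim_disjoint[OF dj]) auto
  moreover have "r * norm w \<le> norm (T w)" if "w \<in> W" for w
  proof (cases "w = 0")
    case False
    define u where "u = (1 / norm w) *\<^sub>R w"
    have "prob (supp M J w) \<le> prob (\<Union>n\<in>{N..}. supp M J (x n))"
      using that unfolding W_def by (intro closure_span_supported) auto
    moreover have "supp M J u = supp M J w"
      using False by (auto simp: supp_def u_def)
    ultimately have "r < norm (T u)"
      using N False by (intro below) (auto simp: u_def)
    then show ?thesis
      using False by (simp add: u_def T.scaleR field_simps)
  qed simp
  ultimately show False
    using ss r unfolding strictly_singular_on_def by blast
qed

text \<open>Vectors with small supports and small images are perturbed into a disjoint sequence by
  removing from each one the supports of all its successors; absolute continuity of the norm makes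
  the perturbation as small as desired.\<close>

lemma bounded_below_if_disj_non_singular:
  assumes oc: "order_continuous TYPE('e)" and T: "bounded_linear T" and dns: "disj_non_singular T"
  shows "\<exists>r>0. \<forall>x. norm x = 1 \<and> prob (supp M J x) < r \<longrightarrow> r < norm (T x)"
proof (rule ccontr)
  assume neg: "\<not> ?thesis"
  interpret T: bounded_linear T by fact
  define P where "P n p \<longleftrightarrow> norm (fst p) = 1 \<and> 0 < snd p \<and> norm (T (fst p)) \<le> (1/2)^n \<and>
    (\<forall>A y. A \<in> sets M \<longrightarrow> prob A < snd p \<longrightarrow> (AE t in M. J y t = indicator A t * J (fst p) t)
      \<longrightarrow> norm y < (1/2)^n / 2)" for n :: nat and p :: "'e \<times> real"
  have step: "\<exists>p. P n p \<and> prob (supp M J (fst p)) < d \<and> snd p \<le> d" if d: "0 < d" for n d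
  proof -
    obtain x where x: "norm x = 1" "prob (supp M J x) < min d ((1/2)^n)"
      "norm (T x) \<le> min d ((1/2)^n)"
    proof -
      have "0 < min d ((1/2)^n)" using d by simp
      then show thesis using neg that by (metis not_less)
    qed
    obtain \<delta> where \<delta>: "0 < \<delta>" "\<And>A y. A \<in> sets M \<Longrightarrow> prob A < \<delta> \<Longrightarrow>
        (AE t in M. J y t = indicator A t * J x t) \<Longrightarrow> norm y < (1/2)^n / 2"
      using norm_absolutely_continuous[OF oc, of "(1/2)^n / 2" x] by auto
    then have "P n (x, min \<delta> d)"
      unfolding P_def using x d by auto
    then show ?thesis
      using x by (intro exI[of _ "(x, min \<delta> d)"]) auto
  qed
  have "\<exists>f. \<forall>n. P n (f n) \<and>
      (prob (supp M J (fst (f (Suc n)))) < snd (f n) / 4 \<and> snd (f (Suc n)) \<le> snd (f n) / 4)"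
  proof (rule dependent_nat_choice)
    show "\<exists>p. P 0 p" using step[of 1 0] by auto
    show "\<exists>q. P (Suc n) q \<and> (prob (supp M J (fst q)) < snd p / 4 \<and> snd q \<le> snd p / 4)"
      if "P n p" for p n
      using step[of "snd p / 4" "Suc n"] that by (simp add: P_def)
  qed
  then obtain f where f: "\<And>n. P n (f n)" "\<And>n. prob (supp M J (fst (f (Suc n)))) < snd (f n) / 4"
    "\<And>n. snd (f (Suc n)) \<le> snd (f n) / 4" by blast
  define x d where "x n = fst (f n)" and "d n = snd (f n)" for n
  have x: "norm (x n) = 1" "norm (T (x n)) \<le> (1/2)^n" and d_pos: "0 < d n" for n
    using f(1)[of n] by (auto simp: P_def x_def d_def)
  have ac: "norm y < (1/2)^n / 2" if "A \<in> sets M" "prob A < d n"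
    "AE t in M. J y t = indicator A t * J (x n) t" for A y n
    using f(1)[of n] that unfolding P_def x_def d_def by blast
  have d: "d (i + j) \<le> d i * (1/2)^j" for i j
  proof (induction j)
    case (Suc j)
    have "d (i + Suc j) \<le> d (i + j) / 4" using f(3)[of "i + j"] by (simp add: d_def)
    also have "\<dots> \<le> d (i + j) / 2" using d_pos[of "i + j"] by simp
    also have "\<dots> \<le> d i * (1/2)^j / 2" using Suc by simp
    finally show ?case by simp
  qed simp
  define B where "B i = (\<Union>j. supp M J (x (Suc (i + j))))" for i
  have B [measurable]: "B i \<in> sets M" for i
    unfolding B_def by (intro sets.countable_UN') auto
  have prob_B: "prob (B i) < d i" for i
  proof -
    have le: "prob (supp M J (x (Suc (i + j)))) \<le> d i / 4 * (1/2)^j" for j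
      using f(2)[of "i + j"] d[of i j] by (simp add: x_def d_def)
    have sums: "(\<lambda>j. d i / 4 * (1/2)^j) sums (d i / 4 * (1 / (1 - 1/2)))"
      by (intro sums_mult geometric_sums) simp
    have summ: "summable (\<lambda>j. prob (supp M J (x (Suc (i + j)))))"
      by (rule summable_comparison_test'[OF sums_summable[OF sums]]) (use le in simp)
    have "prob (B i) \<le> (\<Sum>j. prob (supp M J (x (Suc (i + j)))))"
      unfolding B_def by (rule finite_measure_subadditive_countably) (auto intro: summ)
    also have "\<dots> \<le> (\<Sum>j. d i / 4 * (1/2)^j)"
      by (intro suminf_le le summ sums_summable[OF sums])
    also have "\<dots> = d i / 2"
      using sums_unique[OF sums] by simp
    also have "\<dots> < d i"
      using d_pos[of i] by simp
    finally show ?thesis .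
  qed
  have "\<exists>y. AE t in M. J y t = indicator (space M - B i) t * J (x i) t" for i
  proof -
    have "space M - B i \<in> sets M" by measurable
    then show ?thesis using restriction_exists by metis
  qed
  then obtain y where y: "\<And>i. AE t in M. J (y i) t = indicator (space M - B i) t * J (x i) t"
    by metis
  have close: "norm (x i - y i) < (1/2)^i / 2" for i
  proof (rule ac[OF B prob_B])
    show "AE t in M. J (x i - y i) t = indicator (B i) t * J (x i) t"
      using y[of i] AE_space by eventually_elim (auto simp: indicator_def)
  qed
  have norm_y: "1/2 \<le> norm (y i)" for i
  proof -
    have "norm (x i) \<le> norm (y i) + norm (x i - y i)"
      by (metis norm_triangle_sub)
    moreover have "(1/2::real)^i \<le> 1" by (simp add: power_le_one)
    ultimately show ?thesis using close[of i] x(1)[of i] by linarith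
  qed
  then have nz: "y i \<noteq> 0" for i
    by (metis half_gt_zero norm_zero not_less zero_less_one)
  have disj_less: "AE t in M. J (y i) t = 0 \<or> J (y k) t = 0" if "i < k" for i k
  proof -
    have sub: "supp M J (x k) \<subseteq> B i"
    proof -
      obtain j where "k = Suc (i + j)" using \<open>i < k\<close> less_iff_Suc_add by blast
      then show ?thesis unfolding B_def by blast
    qed
    show ?thesis
      using y[of i] y[of k] AE_space
      by eventually_elim (use sub in \<open>auto simp: supp_def indicator_def\<close>)
  qed
  have "disjoint_seq y"
    unfolding disjoint_seq_def disjoint_iff_AE
  proof clarify
    fix i k :: nat assume "i \<noteq> k"
    then show "AE t in M. J (y i) t = 0 \<or> J (y k) t = 0"
      using disj_less[of i k] disj_less[of k i] by (auto simp: neq_iff disj_commute)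
  qed
  moreover have "strictly_singular_on T (closure (span (range y)))"
  proof (rule strictly_singular_on_disjoint_span[OF T \<open>disjoint_seq y\<close> nz])
    show "0 \<le> 2 * (1 + onorm T)"
      using onorm_pos_le[OF T] by simp
    show "norm (T (y i)) \<le> 2 * (1 + onorm T) * (1/2)^i * norm (y i)" for i
    proof -
      have "norm (T (y i)) \<le> norm (T (x i)) + norm (T (x i - y i))"
        by (metis T.diff norm_minus_commute norm_triangle_sub)
      also have "\<dots> \<le> (1/2)^i + onorm T * (1/2)^i"
      proof (intro add_mono x(2))
        have "norm (T (x i - y i)) \<le> onorm T * norm (x i - y i)" by (rule onorm[OF T])
        also have "\<dots> \<le> onorm T * (1/2)^i"
          using close[of i] norm_ge_zero[of "x i - y i"] onorm_pos_le[OF T]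
          by (intro mult_left_mono) linarith+
        finally show "norm (T (x i - y i)) \<le> onorm T * (1/2)^i" .
      qed
      also have "\<dots> = 2 * (1 + onorm T) * (1/2)^i * (1/2)"
        by (simp add: algebra_simps)
      also have "\<dots> \<le> 2 * (1 + onorm T) * (1/2)^i * norm (y i)"
        using norm_y onorm_pos_le[OF T] by (intro mult_left_mono) auto
      finally show ?thesis .
    qed
  qed
  ultimately show False
    using dns nz unfolding disj_non_singular_def by blast
qed

end

lemma liminf_conditions:
  fixes m g :: "'a::real_normed_vector \<Rightarrow> real"
  assumes m: "\<And>x. 0 \<le> m x"
  defines "null \<equiv> (\<lambda>x::nat \<Rightarrow> 'a. (\<forall>n. norm (x n) = 1) \<and> (\<lambda>n. m (x n)) \<longlonglongrightarrow> 0)"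
  shows "(\<exists>r>0. \<forall>x. norm x = 1 \<and> m x < r \<longrightarrow> r < g x) \<Longrightarrow>
      \<exists>r>0. \<forall>x. null x \<longrightarrow> ereal r < liminf (\<lambda>n. ereal (g (x n)))"
    and "(\<forall>x. null x \<longrightarrow> 0 < liminf (\<lambda>n. ereal (g (x n)))) \<Longrightarrow>
      \<exists>r>0. \<forall>x. norm x = 1 \<and> m x < r \<longrightarrow> r < g x"
proof -
  assume "\<exists>r>0. \<forall>x. norm x = 1 \<and> m x < r \<longrightarrow> r < g x"
  then obtain r where r: "0 < r" "\<And>x. norm x = 1 \<Longrightarrow> m x < r \<Longrightarrow> r < g x" by blast
  have "ereal (r / 2) < liminf (\<lambda>n. ereal (g (x n)))" if x: "null x" for x
  proof -
    have "(\<lambda>n. m (x n)) \<longlonglongrightarrow> 0" using x by (simp add: null_def)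
    then have "\<forall>\<^sub>F n in sequentially. m (x n) < r"
      using r(1) by (rule order_tendstoD(2))
    then have "\<forall>\<^sub>F n in sequentially. ereal r \<le> ereal (g (x n))"
      by eventually_elim (use r(2) x in \<open>auto simp: null_def less_imp_le\<close>)
    then have "ereal r \<le> liminf (\<lambda>n. ereal (g (x n)))"
      by (rule Liminf_bounded)
    moreover have "ereal (r / 2) < ereal r" using r(1) by simp
    ultimately show ?thesis by (rule less_le_trans[rotated])
  qed
  then show "\<exists>r>0. \<forall>x. null x \<longrightarrow> ereal r < liminf (\<lambda>n. ereal (g (x n)))"
    using r(1) by (intro exI[of _ "r / 2"]) auto
next
  assume pos: "\<forall>x. null x \<longrightarrow> 0 < liminf (\<lambda>n. ereal (g (x n)))"
  show "\<exists>r>0. \<forall>x. norm x = 1 \<and> m x < r \<longrightarrow> r < g x"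
  proof (rule ccontr)
    assume neg: "\<not> ?thesis"
    have "\<exists>x. norm x = 1 \<and> m x < inverse (real (Suc n)) \<and> g x \<le> inverse (real (Suc n))" for n
    proof -
      have "0 < inverse (real (Suc n))" by simp
      then show ?thesis using neg by (metis not_less)
    qed
    then obtain x where x: "\<And>n. norm (x n) = 1" "\<And>n. m (x n) < inverse (real (Suc n))"
      "\<And>n. g (x n) \<le> inverse (real (Suc n))" by metis
    have "(\<lambda>n. m (x n)) \<longlonglongrightarrow> 0"
      by (rule tendsto_sandwich[OF _ _ tendsto_const LIMSEQ_inverse_real_of_nat])
        (use m x(2) in \<open>auto intro!: always_eventually less_imp_le\<close>)
    then have "null x" using x(1) by (simp add: null_def)
    then have "0 < liminf (\<lambda>n. ereal (g (x n)))" using pos by blast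
    also have "\<dots> \<le> liminf (\<lambda>n. ereal (inverse (real (Suc n))))"
      by (intro Liminf_mono always_eventually) (use x(3) in auto)
    also have "\<dots> = ereal 0"
      by (intro lim_imp_Liminf tendsto_ereal LIMSEQ_inverse_real_of_nat) simp
    finally show False by (simp add: zero_ereal_def)
  qed
qed

theorem theorem3p1:
  fixes M :: "'w measure"
    and J :: "'e::{banach,ordered_real_vector,lattice} \<Rightarrow> 'w \<Rightarrow> real"
    and T :: "'e \<Rightarrow> 'y::banach"
  assumes lattice_norm: "\<forall>x y::'e. labs x \<le> labs y \<longrightarrow> norm x \<le> norm y"
    and oc: "order_continuous TYPE('e)"
    and wu: "\<exists>e::'e. weak_unit e"
    and rep: "koethe_rep M J"
    and T: "bounded_linear T"
  shows "(disj_non_singular T \<longleftrightarrow>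
            (\<exists>r>0. \<forall>x::nat \<Rightarrow> 'e. (\<forall>n. norm (x n) = 1)
                 \<and> (\<lambda>n. measure M (supp M J (x n))) \<longlonglongrightarrow> 0
                 \<longrightarrow> liminf (\<lambda>n. ereal (norm (T (x n)))) > ereal r))
       \<and> (disj_non_singular T \<longleftrightarrow>
            (\<forall>x::nat \<Rightarrow> 'e. (\<forall>n. norm (x n) = 1)
                 \<and> (\<lambda>n. measure M (supp M J (x n))) \<longlonglongrightarrow> 0
                 \<longrightarrow> liminf (\<lambda>n. ereal (norm (T (x n)))) > 0))
       \<and> (disj_non_singular T \<longleftrightarrow>
            (\<exists>r>0. \<forall>x::'e. norm x = 1 \<and> measure M (supp M J x) < r \<longrightarrow> norm (T x) > r))"
proof -
  interpret koethe_space M J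
    using rep lattice_norm
    by (auto simp: koethe_space_def koethe_space_axioms_def koethe_rep_def)
  let ?null = "\<lambda>x. (\<forall>n. norm (x n) = 1) \<and> (\<lambda>n. measure M (supp M J (x n))) \<longlonglongrightarrow> 0"
  let ?c4 = "\<exists>r>0. \<forall>x::'e. norm x = 1 \<and> measure M (supp M J x) < r \<longrightarrow> norm (T x) > r"
  let ?c2 = "\<exists>r>0. \<forall>x. ?null x \<longrightarrow> liminf (\<lambda>n. ereal (norm (T (x n)))) > ereal r"
  let ?c3 = "\<forall>x. ?null x \<longrightarrow> liminf (\<lambda>n. ereal (norm (T (x n)))) > 0"
  have "disj_non_singular T \<longleftrightarrow> ?c4"
    using bounded_below_if_disj_non_singular[OF oc T] disj_non_singular_if_bounded_below[OF T] by blast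
  moreover have "?c4 \<Longrightarrow> ?c2"
    by (rule liminf_conditions(1)) simp_all
  moreover have "?c2 \<Longrightarrow> ?c3"
    by (meson ereal_less(2) order.strict_trans)
  moreover have "?c3 \<Longrightarrow> ?c4"
    by (rule liminf_conditions(2)) simp_all
  ultimately show ?thesis by argo
qed

end
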